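(* For every integer $n \ge 2$, the upper rank of the semigroup $A^+(B_n)$ satisfies $r_4(A^+(B_n)) \ge n!\,\lfloor n^2/4\rfloor + n + 2$.
   Context: Brandt semigroup. For $n\ge 1$ let $[n]=\{1,\dots,n\}$ and $B_n = ([n]\times[n])\cup\{\vartheta\}$, with the (non-commutative) operation $+$ given by $(i,j)+(k,l)=(i,l)$ if $j=k$ and $(i,j)+(k,l)=\vartheta$ otherwise, and $\vartheta+x=x+\vartheta=\vartheta$ for all $x\in B_n$. Affine maps. Arguments of functions are written on the left ($xf$ is the value of $f$ at $x$), so $x(fg)=(xf)g$. Let $M(B_n)$ be the set of all maps $B_n\to B_n$, with pointwise addition $+$ and composition. A map is affine if it equals $g+h$ with $g$ an endomorphism of $(B_n,+)$ and $h$ a constant map; $\mathrm{Aff}(B_n)$ is the set of affine maps. $A^+(B_n)$ is the smallest subset of $M(B_n)$ containing $\mathrm{Aff}(B_n)$ and closed under $+$ and composition; here it is regarded as a semigroup under composition only. Explicit description (known). For $c\in B_n$ let $\xi_c$ be the constant map with value $c$; for $k,l,p,q\in[n]$ let ${}^{(k,l)}\zeta_{(p,q)}$ be the map sending $(k,l)$ to $(p,q)$ and all other elements to $\vartheta$; for $p,q\in[n]$ and a permutation $\sigma\in S_n$ let $(p,q;\sigma)$ be the map sending $(i,p)$ to $(i\sigma,q)$ for all $i\in[n]$ and all other elements to $\vartheta$. For $n\ge 2$, $A^+(B_n)=\{(p,q;\sigma): p,q\in[n],\sigma\in S_n\}\cup\{\xi_c : c\in B_n\}\cup\{{}^{(k,l)}\zeta_{(p,q)}: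 k,l,p,q\in[n]\}$. Rank. A subset $U$ of a semigroup $\Gamma$ is independent if $a\notin\langle U\setminus\{a\}\rangle$ for every $a\in U$, where $\langle X\rangle$ is the subsemigroup generated by $X$ (with $\langle\emptyset\rangle=\emptyset$). For a finite semigroup $\Gamma$, the upper rank is $r_4(\Gamma)=\max\{|U| : U\subseteq\Gamma,\ U\text{ is independent}\}$. *)

theory Defs
  imports Main "HOL-Library.FuncSet"
begin

datatype brandt = Theta | Elt nat nat

definition Brandt :: "nat \<Rightarrow> brandt set" where
  "Brandt n = {Elt i j | i j. i \<in> {1..n} \<and> j \<in> {1..n}} \<union> {Theta}"

fun brandt_add :: "brandt \<Rightarrow> brandt \<Rightarrow> brandt" (infixl \<open>\<oplus>\<close> 65) where
  "Elt i j \<oplus> Elt k l = (if j = k then Elt i l else Theta)"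
| "Theta \<oplus> x = Theta"
| "x \<oplus> Theta = Theta"

text \<open>Self-maps of \<open>Brandt n\<close> are represented by extensional functions, so that equality of
  functions is equality of maps on the carrier.\<close>

definition map_add :: "nat \<Rightarrow> (brandt \<Rightarrow> brandt) \<Rightarrow> (brandt \<Rightarrow> brandt) \<Rightarrow> brandt \<Rightarrow> brandt" where
  "map_add n f g = (\<lambda>x\<in>Brandt n. f x \<oplus> g x)"

text \<open>Arguments are written on the left of maps: the product \<open>f g\<close> applies \<open>f\<close> first.\<close>

definition map_mult :: "nat \<Rightarrow> (brandt \<Rightarrow> brandt) \<Rightarrow> (brandt \<Rightarrow> brandt) \<Rightarrow> brandt \<Rightarrow> brandt" where
  "map_mult n f g = compose (Brandt n) g f"

definition endomorphisms :: "nat \<Rightarrow> (brandt \<Rightarrow> brandt) set" where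
  "endomorphisms n = {g \<in> Brandt n \<rightarrow>\<^sub>E Brandt n.
     \<forall>x\<in>Brandt n. \<forall>y\<in>Brandt n. g (x \<oplus> y) = g x \<oplus> g y}"

definition const_map :: "nat \<Rightarrow> brandt \<Rightarrow> brandt \<Rightarrow> brandt" where
  "const_map n c = (\<lambda>x\<in>Brandt n. c)"

definition Aff :: "nat \<Rightarrow> (brandt \<Rightarrow> brandt) set" where
  "Aff n = {map_add n g (const_map n c) | g c. g \<in> endomorphisms n \<and> c \<in> Brandt n}"

inductive_set A_plus :: "nat \<Rightarrow> (brandt \<Rightarrow> brandt) set" for n :: nat where
  aff: "f \<in> Aff n \<Longrightarrow> f \<in> A_plus n"
| add: "f \<in> A_plus n \<Longrightarrow> g \<in> A_plus n \<Longrightarrow> map_add n f g \<in> A_plus n"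
| mult: "f \<in> A_plus n \<Longrightarrow> g \<in> A_plus n \<Longrightarrow> map_mult n f g \<in> A_plus n"

text \<open>A semigroup is given by a carrier set and an operation \<open>m\<close> under which it is closed.\<close>

inductive_set subsemigroup_generated :: "('a \<Rightarrow> 'a \<Rightarrow> 'a) \<Rightarrow> 'a set \<Rightarrow> 'a set"
  for m :: "'a \<Rightarrow> 'a \<Rightarrow> 'a" and X :: "'a set" where
  incl: "x \<in> X \<Longrightarrow> x \<in> subsemigroup_generated m X"
| mult: "x \<in> subsemigroup_generated m X \<Longrightarrow> y \<in> subsemigroup_generated m X
    \<Longrightarrow> m x y \<in> subsemigroup_generated m X"

definition independent_subset :: "('a \<Rightarrow> 'a \<Rightarrow> 'a) \<Rightarrow> 'a set \<Rightarrow> bool" where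
  "independent_subset m U \<longleftrightarrow> (\<forall>a\<in>U. a \<notin> subsemigroup_generated m (U - {a}))"

text \<open>Meaningful for finite \<open>G\<close> only, where the maximum is over a finite set containing
  \<open>card {} = 0\<close>; see \<open>finite_A_plus\<close> below.\<close>

definition upper_rank :: "'a set \<Rightarrow> ('a \<Rightarrow> 'a \<Rightarrow> 'a) \<Rightarrow> nat" where
  "upper_rank G m = Max {card U | U. U \<subseteq> G \<and> independent_subset m U}"

lemma Brandt_add_closed: "x \<in> Brandt n \<Longrightarrow> y \<in> Brandt n \<Longrightarrow> x \<oplus> y \<in> Brandt n"
  by (cases x; cases y) (auto simp: Brandt_def)

lemma finite_Brandt: "finite (Brandt n)"
proof -
  have "Brandt n = (\<lambda>(i, j). Elt i j) ` ({1..n} \<times> {1..n}) \<union> {Theta}"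
    by (auto simp: Brandt_def)
  then show ?thesis by simp
qed

lemma A_plus_subset: "A_plus n \<subseteq> Brandt n \<rightarrow>\<^sub>E Brandt n"
proof
  fix f assume "f \<in> A_plus n"
  then show "f \<in> Brandt n \<rightarrow>\<^sub>E Brandt n"
  proof induction
    case (aff f)
    then show ?case
      by (fastforce simp: Aff_def endomorphisms_def map_add_def const_map_def
          intro: Brandt_add_closed)
  next
    case (add f g)
    then show ?case
      by (auto simp: map_add_def intro!: Brandt_add_closed)
  next
    case (mult f g)
    then show ?case
      by (auto simp: map_mult_def compose_def)
  qed
qed

lemma finite_A_plus: "finite (A_plus n)"
  by (rule finite_subset[OF A_plus_subset]) (simp add: finite_PiE finite_Brandt)

end

theory Submission
  imports Defs "HOL-Combinatorics.Permutations"
begin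

text \<open>Split \<open>{1..n}\<close> into \<open>{1..m}\<close> and \<open>{m+1..n}\<close> with \<open>m = n div 2\<close>. If every map in a family sends
  everything outside \<open>{1..n} \<times> {1..m}\<close> to \<open>Theta\<close> and has all its other values in
  \<open>{1..n} \<times> {m+1..n}\<close>, then any product of two members is the zero map. Hence all such nonzero maps
  together form an independent set. It contains \<open>n! m (n - m)\<close> maps \<open>(p,q;\<sigma>)\<close> and at least
  \<open>n\<^sup>2 \<ge> n + 2\<close> maps \<open>\<zeta>\<close> supported on a single point.\<close>

text \<open>Generating from \<open>U - {a}\<close> adds at most \<open>z\<close>, since every
  product collapses to \<open>z\<close>; and \<open>a\<close> differs from \<open>z\<close> because
  \<open>z\<close> is outside \<open>U\<close>.\<close>

lemma independent_subset_null:
  assumes null: "\<And>x y. x \<in> insert z U \<Longrightarrow> y \<in> insert z U \<Longrightarrow> m x y = z"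
    and "z \<notin> U"
  shows "independent_subset m U"
  unfolding independent_subset_def
proof
  fix a assume a: "a \<in> U"
  have "x \<in> insert z (U - {a})" if "x \<in> subsemigroup_generated m (U - {a})" for x
    using that by induction (use null in auto)
  then show "a \<notin> subsemigroup_generated m (U - {a})"
    using a \<open>z \<notin> U\<close> by blast
qed

lemma card_le_upper_rank:
  assumes "finite G" "U \<subseteq> G" "independent_subset m U"
  shows "card U \<le> upper_rank G m"
proof -
  have "{card U | U. U \<subseteq> G \<and> independent_subset m U} \<subseteq> card ` Pow G"
    by auto
  then have "finite {card U | U. U \<subseteq> G \<and> independent_subset m U}"
    using assms(1) by (meson finite_Pow_iff finite_imageI finite_subset)
  then show ?thesis
    unfolding upper_rank_def using assms(2,3) by (intro Max_ge) auto
qed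

lemma Theta_in_Brandt [simp]: "Theta \<in> Brandt n"
  by (simp add: Brandt_def)

lemma Elt_in_Brandt [simp]: "Elt i j \<in> Brandt n \<longleftrightarrow> i \<in> {1..n} \<and> j \<in> {1..n}"
  by (simp add: Brandt_def)

lemma brandt_add_Theta_right [simp]: "x \<oplus> Theta = Theta"
  by (cases x) auto

text \<open>For a permutation \<sigma> this is an automorphism of the Brandt semigroup; it serves as
  the endomorphism part of the affine map \<open>perm_map\<close>.\<close>

definition auto_map :: "nat \<Rightarrow> (nat \<Rightarrow> nat) \<Rightarrow> brandt \<Rightarrow> brandt" where
  "auto_map n \<sigma> = (\<lambda>x\<in>Brandt n. case x of Theta \<Rightarrow> Theta | Elt i j \<Rightarrow> Elt (\<sigma> i) (\<sigma> j))"

text \<open>The map written (p,q;\<sigma>) in the explicit description of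
  \<open>A_plus n\<close>.\<close>

definition perm_map :: "nat \<Rightarrow> nat \<Rightarrow> nat \<Rightarrow> (nat \<Rightarrow> nat) \<Rightarrow> brandt \<Rightarrow> brandt" where
  "perm_map n p q \<sigma> = (\<lambda>x\<in>Brandt n. case x of Theta \<Rightarrow> Theta
     | Elt i j \<Rightarrow> if j = p then Elt (\<sigma> i) q else Theta)"

definition zeta_map :: "nat \<Rightarrow> brandt \<Rightarrow> brandt \<Rightarrow> brandt \<Rightarrow> brandt" where
  "zeta_map n a b = (\<lambda>x\<in>Brandt n. if x = a then b else Theta)"

text \<open>Injectivity of \<sigma> keeps unequal inner indices unequal, so sums equal to
  \<open>Theta\<close> are preserved too.\<close>

lemma auto_map_endomorphism:
  assumes "\<sigma> permutes {1..n}"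
  shows "auto_map n \<sigma> \<in> endomorphisms n"
proof -
  have inj: "\<sigma> i = \<sigma> j \<longleftrightarrow> i = j" for i j
    using permutes_inj[OF assms] by (auto dest: injD)
  have "auto_map n \<sigma> (x \<oplus> y) = auto_map n \<sigma> x \<oplus> auto_map n \<sigma> y"
    if "x \<in> Brandt n" "y \<in> Brandt n" for x y
    using that by (cases x; cases y) (auto simp: auto_map_def inj)
  moreover have "auto_map n \<sigma> \<in> Brandt n \<rightarrow>\<^sub>E Brandt n"
    using permutes_in_image[OF assms]
    by (auto simp: auto_map_def simp del: atLeastAtMost_iff split: brandt.splits)
  ultimately show ?thesis
    by (simp add: endomorphisms_def)
qed

text \<open>\<open>Elt i i\<close> is idempotent, so its constant map is an endomorphism, and it is
  a left identity for \<open>Elt i j\<close>.\<close>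

lemma const_map_in_A_plus:
  assumes "i \<in> {1..n}" "j \<in> {1..n}"
  shows "const_map n (Elt i j) \<in> A_plus n"
proof -
  have "const_map n (Elt i i) \<in> endomorphisms n"
    using assms by (auto simp: endomorphisms_def const_map_def intro!: Brandt_add_closed
        dest: Brandt_add_closed)
  moreover have "map_add n (const_map n (Elt i i)) (const_map n (Elt i j)) = const_map n (Elt i j)"
    by (auto simp: map_add_def const_map_def fun_eq_iff)
  ultimately have "const_map n (Elt i j) \<in> Aff n"
    unfolding Aff_def using assms by (force intro: sym)
  then show ?thesis by (rule A_plus.aff)
qed

text \<open>Adding \<open>Elt (\<sigma> p) q\<close> on the right of
  \<open>Elt (\<sigma> i) (\<sigma> j)\<close> gives \<open>Theta\<close> unless
  \<open>\<sigma> j = \<sigma> p\<close>, that is, \<open>j = p\<close>.\<close>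

lemma perm_map_in_A_plus:
  assumes "\<sigma> permutes {1..n}" "p \<in> {1..n}" "q \<in> {1..n}"
  shows "perm_map n p q \<sigma> \<in> A_plus n"
proof -
  have inj: "\<sigma> i = \<sigma> j \<longleftrightarrow> i = j" for i j
    using permutes_inj[OF assms(1)] by (auto dest: injD)
  have "perm_map n p q \<sigma> = map_add n (auto_map n \<sigma>) (const_map n (Elt (\<sigma> p) q))"
    by (auto simp: perm_map_def map_add_def auto_map_def const_map_def inj fun_eq_iff
        split: brandt.splits)
  moreover have "Elt (\<sigma> p) q \<in> Brandt n"
    using assms permutes_in_image[OF assms(1)] by (simp del: atLeastAtMost_iff)
  ultimately have "perm_map n p q \<sigma> \<in> Aff n"
    unfolding Aff_def using auto_map_endomorphism[OF assms(1)] by blast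
  then show ?thesis by (rule A_plus.aff)
qed

text \<open>\<open>perm_map n l q id\<close> sends \<open>Elt i l\<close> to \<open>Elt i q\<close>;
  adding \<open>Elt p k\<close> on the left keeps only \<open>i = k\<close> and changes the value
  there to \<open>Elt p q\<close>.\<close>

lemma zeta_map_in_A_plus:
  assumes "k \<in> {1..n}" "l \<in> {1..n}" "p \<in> {1..n}" "q \<in> {1..n}"
  shows "zeta_map n (Elt k l) (Elt p q) \<in> A_plus n"
proof -
  have "zeta_map n (Elt k l) (Elt p q) = map_add n (const_map n (Elt p k)) (perm_map n l q id)"
    by (auto simp: zeta_map_def map_add_def const_map_def perm_map_def fun_eq_iff
        split: brandt.splits)
  then show ?thesis
    using assms const_map_in_A_plus perm_map_in_A_plus[OF permutes_id] A_plus.add by metis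
qed

text \<open>The zero map qualifies vacuously, so products that involve it are covered by the same
  argument.\<close>

definition split_maps :: "nat \<Rightarrow> nat \<Rightarrow> (brandt \<Rightarrow> brandt) set" where
  "split_maps n m = {f \<in> Brandt n \<rightarrow>\<^sub>E Brandt n. \<forall>x\<in>Brandt n.
     f x \<noteq> Theta \<longrightarrow> (\<exists>i j. x = Elt i j \<and> j \<le> m) \<and> (\<exists>i j. f x = Elt i j \<and> m < j)}"

lemma split_maps_null:
  assumes "f \<in> split_maps n m" "g \<in> split_maps n m"
  shows "map_mult n f g = const_map n Theta"
proof
  fix x
  show "map_mult n f g x = const_map n Theta x"
  proof (cases "x \<in> Brandt n")
    case True
    then have fx: "f x \<in> Brandt n"
      using assms(1) by (auto simp: split_maps_def)
    have "g (f x) = Theta"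
    proof (rule ccontr)
      assume "g (f x) \<noteq> Theta"
      then obtain i j where "f x = Elt i j" "j \<le> m"
        using assms(2) fx unfolding split_maps_def by blast
      \<comment> \<open>Here \<open>f x\<close> is not \<open>Theta\<close>, so membership of
        \<open>f\<close> in \<open>split_maps n m\<close> puts its second index above
        \<open>m\<close>.\<close>
      then show False
        using assms(1) True by (force simp: split_maps_def)
    qed
    then show ?thesis
      using True by (simp add: map_mult_def compose_def const_map_def)
  qed (simp add: map_mult_def compose_def const_map_def)
qed

lemma perm_map_in_split_maps:
  assumes "\<sigma> permutes {1..n}" "p \<le> m" "m < q" "q \<le> n"
  shows "perm_map n p q \<sigma> \<in> split_maps n m"
  using assms permutes_in_image[OF assms(1)]
  by (auto simp: split_maps_def perm_map_def split: brandt.splits if_splits)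

lemma zeta_map_in_split_maps:
  assumes "p \<in> {1..n}" "l \<le> m" "m < q" "q \<le> n"
  shows "zeta_map n (Elt k l) (Elt p q) \<in> split_maps n m"
  using assms by (auto simp: split_maps_def zeta_map_def)

lemma perm_map_inject:
  assumes "\<sigma> permutes {1..n}" "\<sigma>' permutes {1..n}" "p \<in> {1..n}"
    and eq: "perm_map n p q \<sigma> = perm_map n p' q' \<sigma>'"
  shows "\<sigma> = \<sigma>' \<and> p = p' \<and> q = q'"
proof -
  \<comment> \<open>At \<open>Elt i p\<close> the left map is not \<open>Theta\<close>, which forces
    \<open>p = p'\<close>; the values then give the rest.\<close>
  have *: "p = p' \<and> \<sigma> i = \<sigma>' i \<and> q = q'" if "i \<in> {1..n}" for i
    using fun_cong[OF eq, of "Elt i p"] that assms(3)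
    by (auto simp: perm_map_def split: if_splits)
  \<comment> \<open>Outside \<open>{1..n}\<close> both permutations are the identity.\<close>
  moreover have "\<sigma> i = \<sigma>' i" for i
    using * assms(1,2) by (metis permutes_not_in)
  ultimately show ?thesis
    using assms(3) by blast
qed

lemma inj_on_perm_map:
  "inj_on (\<lambda>(\<sigma>, p, q). perm_map n p q \<sigma>) ({\<sigma>. \<sigma> permutes {1..n}} \<times> {1..n} \<times> {1..n})"
  by (rule inj_onI) (auto simp del: atLeastAtMost_iff One_nat_def dest: perm_map_inject)

lemma zeta_map_inject:
  assumes "a \<in> Brandt n" "b \<noteq> Theta" and eq: "zeta_map n a b = zeta_map n a' b'"
  shows "a = a' \<and> b = b'"
  using fun_cong[OF eq, of a] assms(1,2) by (simp add: zeta_map_def split: if_splits)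

lemma inj_on_zeta_map:
  "inj_on (\<lambda>(a, b). zeta_map n a b) ((Brandt n - {Theta}) \<times> (Brandt n - {Theta}))"
  by (rule inj_onI) (auto dest: zeta_map_inject)

text \<open>The left map is nonzero at two points, \<open>Elt 1 p\<close> and
  \<open>Elt 2 p\<close>, the right one at no more than one.\<close>

lemma perm_map_neq_zeta_map:
  assumes "2 \<le> n" "p \<in> {1..n}"
  shows "perm_map n p q \<sigma> \<noteq> zeta_map n a b"
proof
  assume eq: "perm_map n p q \<sigma> = zeta_map n a b"
  have "a = Elt 1 p" "a = Elt 2 p"
    using fun_cong[OF eq, of "Elt 1 p"] fun_cong[OF eq, of "Elt 2 p"] assms
    by (auto simp: perm_map_def zeta_map_def split: if_splits)
  then show False by simp
qed

lemma const_Theta_neq_perm_map: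
  assumes "p \<in> {1..n}"
  shows "const_map n Theta \<noteq> perm_map n p q \<sigma>"
proof
  assume "const_map n Theta = perm_map n p q \<sigma>"
  from fun_cong[OF this, of "Elt p p"] show False
    using assms by (simp add: const_map_def perm_map_def)
qed

lemma const_Theta_neq_zeta_map:
  assumes "a \<in> Brandt n" "b \<noteq> Theta"
  shows "const_map n Theta \<noteq> zeta_map n a b"
proof
  assume "const_map n Theta = zeta_map n a b"
  from fun_cong[OF this, of a] show False
    using assms by (simp add: const_map_def zeta_map_def)
qed

text \<open>For n = 2k both sides are k*k; for n = 2k+1 both are k(k+1), as the square of n is
  4k(k+1) + 1.\<close>

lemma div2_mult_complement: "(n div 2) * (n - n div 2) = n\<^sup>2 div 4" for n :: nat
proof (cases "even n")
  case True
  then obtain k where "n = 2 * k" by (elim evenE)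
  then show ?thesis by (simp add: power2_eq_square)
next
  case False
  then obtain k where "n = 2 * k + 1" by (elim oddE)
  then show ?thesis by (simp add: power2_eq_square algebra_simps)
qed

theorem theorem4p5:
  fixes n :: nat
  assumes "n \<ge> 2"
  shows "upper_rank (A_plus n) (map_mult n) \<ge> fact n * (n\<^sup>2 div 4) + n + 2"
proof -
  define m where "m = n div 2"
  have m: "1 \<le> m" "m < n"
    using assms by (auto simp: m_def)
  define I where "I = {\<sigma>. \<sigma> permutes {1..n}} \<times> {1..m} \<times> {m<..n}"
  \<comment> \<open>The second indices are fixed at 1 \<le> m for the source and n > m for the
    value; the two free first indices already give \<open>n * n\<close> maps.\<close>
  define J where "J = (\<lambda>k. Elt k 1) ` {1..n} \<times> (\<lambda>k. Elt k n) ` {1..n}"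
  define V where "V = (\<lambda>(\<sigma>, p, q). perm_map n p q \<sigma>) ` I"
  define W where "W = (\<lambda>(a, b). zeta_map n a b) ` J"
  have "V \<union> W \<subseteq> A_plus n"
    using m by (auto simp: V_def W_def I_def J_def intro!: perm_map_in_A_plus zeta_map_in_A_plus)
  moreover have "independent_subset (map_mult n) (V \<union> W)"
  proof (rule independent_subset_null)
    have "const_map n Theta \<in> split_maps n m"
      by (auto simp: split_maps_def const_map_def)
    then have "insert (const_map n Theta) (V \<union> W) \<subseteq> split_maps n m"
      using m by (auto simp: V_def W_def I_def J_def
          intro!: perm_map_in_split_maps zeta_map_in_split_maps)
    then show "map_mult n x y = const_map n Theta"
      if "x \<in> insert (const_map n Theta) (V \<union> W)" "y \<in> insert (const_map n Theta) (V \<union> W)" for x y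
      using that by (intro split_maps_null) blast+
    \<comment> \<open>Each map in \<open>V\<close> or \<open>W\<close> has a value other than
      \<open>Theta\<close>.\<close>
    show "const_map n Theta \<notin> V \<union> W"
      using m by (auto simp: V_def W_def I_def J_def
          dest!: const_Theta_neq_perm_map[THEN notE, rotated]
            const_Theta_neq_zeta_map[THEN notE, rotated 2])
  qed
  ultimately have "card (V \<union> W) \<le> upper_rank (A_plus n) (map_mult n)"
    by (intro card_le_upper_rank finite_A_plus)
  moreover have "card (V \<union> W) = card I + card J"
  proof -
    have "finite I" "finite J"
      by (auto simp: I_def J_def finite_permutations)
    moreover have "card V = card I"
      unfolding V_def I_def using m
      by (intro card_image inj_on_subset[OF inj_on_perm_map]) auto
    moreover have "card W = card J"
      unfolding W_def J_def using m
      by (intro card_image inj_on_subset[OF inj_on_zeta_map]) auto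
    moreover have "V \<inter> W = {}"
      using perm_map_neq_zeta_map[OF assms] m by (fastforce simp: V_def W_def I_def)
    ultimately show ?thesis
      by (simp add: V_def W_def card_Un_disjoint)
  qed
  moreover have "card I = fact n * (n\<^sup>2 div 4)"
    using card_permutations[of "{1..n}" n]
    by (simp add: I_def card_cartesian_product m_def div2_mult_complement)
  moreover have "card J = n * n"
    by (simp add: J_def card_cartesian_product card_image inj_on_def)
  \<comment> \<open>From n \<ge> 2 follow n + 2 \<le> 2n and 2n \<le> n*n.\<close>
  moreover have "n + 2 \<le> n * n"
    using mult_le_mono1[OF assms, of n] assms by linarith
  ultimately show ?thesis by linarith
qed

end
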